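(* Let $G$ be an abelian group, let $\Gamma,\Theta:\mathbb{Z}_2\to \mathrm{Aut}(G)$ be group homomorphisms, and let $(G\rtimes_\Gamma\mathbb{Z}_2,*_\Gamma)$ and $(G\rtimes_\Theta\mathbb{Z}_2,*_\Theta)$ be the corresponding semidirect products. Let $X,Y$ be subsets of the Cartesian product $G\times\mathbb{Z}_2$. If $\Gamma_1(Y)=\Theta_1(Y)$, then: (i) $S(X,Y;G\rtimes_\Gamma\mathbb{Z}_2)=S(X,Y;G\rtimes_\Theta\mathbb{Z}_2)$ (as multisets); (ii) for every positive integer $\lambda$, $(X;Y)$ is a $\lambda$-fold near-factorization of $G\rtimes_\Gamma\mathbb{Z}_2$ if and only if $(X;Y)$ is a $\lambda$-fold near-factorization of $G\rtimes_\Theta\mathbb{Z}_2$.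
   Context: For a homomorphism $\Gamma:\mathbb{Z}_2\to\mathrm{Aut}(G)$, write $\Gamma_h$ for the automorphism associated to $h\in\mathbb{Z}_2=\{0,1\}$. The semidirect product $G\rtimes_\Gamma\mathbb{Z}_2$ has underlying set the Cartesian product $G\times\mathbb{Z}_2$ and multiplication $(g_1,h_1)*_\Gamma(g_2,h_2)=(g_1\Gamma_{h_1}(g_2),h_1+h_2)$. All semidirect products of $G$ and $\mathbb{Z}_2$ thus share the same underlying set. An automorphism $f$ of $G$ is extended to the set $G\times\mathbb{Z}_2$ by $f(x,y)=(f(x),y)$; in particular, for $Y\subseteq G\times\mathbb{Z}_2$, $\Gamma_1(Y)=\{(\Gamma_1(g),h):(g,h)\in Y\}$. For a group $K$ with multiplication $*$ and subsets $X,Y\subseteq K$, $S(X,Y;K)$ denotes the multiset $\{x*y:x\in X,\,y\in Y\}$. For a multiset $D$, $\lambda D$ denotes the multiset consisting of $\lambda$ copies of $D$. For a group $K$ with identity $e$ and subsets $X,Y\subseteq K$ with $|X|=k$, $|Y|=l$, $(X;Y)$ is a $\lambda$-fold $(k,l)$-near-factorization of $K$ (or simply a $\lambda$-fold near-factorization) if $S(X,Y;K)=\lambda(K\setminus\{e\})$ as multisets. *)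

theory Defs
  imports
    "HOL-Algebra.Bij"
    "HOL-Algebra.Elementary_Groups"
    "HOL-Library.Equipollence"
    "HOL-Library.Multiset"
begin

definition semidirect_product ::
  "('a, 'c) monoid_scheme \<Rightarrow> ('h, 'd) monoid_scheme \<Rightarrow> ('h \<Rightarrow> 'a \<Rightarrow> 'a) \<Rightarrow> ('a \<times> 'h) monoid" where
  "semidirect_product G H \<Gamma> =
     \<lparr>carrier = carrier G \<times> carrier H,
      monoid.mult = (\<lambda>(g1, h1) (g2, h2). (g1 \<otimes>\<^bsub>G\<^esub> \<Gamma> h1 g2, h1 \<otimes>\<^bsub>H\<^esub> h2)),
      one = (\<one>\<^bsub>G\<^esub>, \<one>\<^bsub>H\<^esub>)\<rparr>"

lemma group_semidirect_product:
  assumes "group G" "group H" and hom: "\<Gamma> \<in> hom H (AutoGroup G)"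
  shows "group (semidirect_product G H \<Gamma>)"
proof -
  interpret G: group G by fact
  interpret H: group H by fact
  have au: "\<Gamma> h \<in> hom G G" "bij_betw (\<Gamma> h) (carrier G) (carrier G)" "\<Gamma> h \<in> Bij (carrier G)"
    if "h \<in> carrier H" for h
    using hom that by (auto simp: hom_def AutoGroup_def auto_def Bij_def)
  have cl: "\<Gamma> h g \<in> carrier G" if "h \<in> carrier H" "g \<in> carrier G" for h g
    using au(1)[OF that(1)] that(2) by (auto simp: hom_def)
  have mu: "\<Gamma> h (a \<otimes>\<^bsub>G\<^esub> b) = \<Gamma> h a \<otimes>\<^bsub>G\<^esub> \<Gamma> h b"
    if "h \<in> carrier H" "a \<in> carrier G" "b \<in> carrier G" for h a b
    using au(1)[OF that(1)] that by (auto simp: hom_def)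
  have comp: "\<Gamma> (h \<otimes>\<^bsub>H\<^esub> k) a = \<Gamma> h (\<Gamma> k a)"
    if "h \<in> carrier H" "k \<in> carrier H" "a \<in> carrier G" for h k a
    using hom that au(3) by (simp add: hom_def AutoGroup_def BijGroup_def compose_def)
  have one: "\<Gamma> \<one>\<^bsub>H\<^esub> a = a" if "a \<in> carrier G" for a
  proof -
    have "\<Gamma> \<one>\<^bsub>H\<^esub> (\<Gamma> \<one>\<^bsub>H\<^esub> a) = \<Gamma> \<one>\<^bsub>H\<^esub> a"
      using comp[of "\<one>\<^bsub>H\<^esub>" "\<one>\<^bsub>H\<^esub>" a] that by simp
    then show ?thesis
      using au(2)[OF H.one_closed] cl[OF H.one_closed that] that
      by (meson bij_betw_imp_inj_on inj_onD)
  qed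
  show ?thesis
  proof (rule groupI)
    fix x assume "x \<in> carrier (semidirect_product G H \<Gamma>)"
    then obtain g h where x: "x = (g, h)" "g \<in> carrier G" "h \<in> carrier H"
      by (auto simp: semidirect_product_def)
    let ?y = "(\<Gamma> (inv\<^bsub>H\<^esub> h) (inv\<^bsub>G\<^esub> g), inv\<^bsub>H\<^esub> h)"
    have "\<Gamma> (inv\<^bsub>H\<^esub> h) (inv\<^bsub>G\<^esub> g) \<otimes>\<^bsub>G\<^esub> \<Gamma> (inv\<^bsub>H\<^esub> h) g = \<Gamma> (inv\<^bsub>H\<^esub> h) \<one>\<^bsub>G\<^esub>"
      using x mu[of "inv\<^bsub>H\<^esub> h" "inv\<^bsub>G\<^esub> g" g] by simp
    also have "\<dots> = \<one>\<^bsub>G\<^esub>"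
      using x au(1)[of "inv\<^bsub>H\<^esub> h"] by (simp add: hom_one[OF _ \<open>group G\<close> \<open>group G\<close>])
    finally show "\<exists>y\<in>carrier (semidirect_product G H \<Gamma>).
        y \<otimes>\<^bsub>semidirect_product G H \<Gamma>\<^esub> x = \<one>\<^bsub>semidirect_product G H \<Gamma>\<^esub>"
      using x cl by (intro bexI[of _ ?y]) (auto simp: semidirect_product_def)
  qed (auto simp: semidirect_product_def cl mu comp one G.m_assoc H.m_assoc)
qed

text \<open>
  The groups are not assumed to be finite, so the multisets below may be infinite and may have
  infinite multiplicities; the type of library multisets is too small for them. A multiset
  is therefore given as a family \<open>(I, f)\<close>, whose members are the \<open>f i\<close> for \<open>i \<in> I\<close>, and
  equality of multisets is equality of families up to a bijective reindexing. The lemmas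
  below show that this says that all multiplicities agree as cardinal numbers, and that for finite
  families it is equality of library multisets.
\<close>

type_synonym ('i, 'a) family = "'i set \<times> ('i \<Rightarrow> 'a)"

definition mset_eq :: "('i, 'a) family \<Rightarrow> ('j, 'a) family \<Rightarrow> bool" (infix \<open>=\<^sub>m\<close> 50) where
  "D =\<^sub>m E \<longleftrightarrow> (\<exists>b. bij_betw b (fst D) (fst E) \<and> (\<forall>i\<in>fst D. snd E (b i) = snd D i))"

lemma mset_eq_iff_multiplicities:
  "(I, f) =\<^sub>m (J, g) \<longleftrightarrow> (\<forall>z. {i \<in> I. f i = z} \<approx> {j \<in> J. g j = z})"
proof
  assume "(I, f) =\<^sub>m (J, g)"
  then obtain b where b: "bij_betw b I J" "\<And>i. i \<in> I \<Longrightarrow> g (b i) = f i"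
    by (auto simp: mset_eq_def)
  have "bij_betw b {i \<in> I. f i = z} {j \<in> J. g j = z}" for z
    using b by (auto simp: bij_betw_def inj_on_def image_iff)
  then show "\<forall>z. {i \<in> I. f i = z} \<approx> {j \<in> J. g j = z}"
    unfolding eqpoll_def by blast
next
  assume "\<forall>z. {i \<in> I. f i = z} \<approx> {j \<in> J. g j = z}"
  then have "\<forall>z. \<exists>b. bij_betw b {i \<in> I. f i = z} {j \<in> J. g j = z}"
    by (simp add: eqpoll_def)
  then obtain B where B: "\<And>z. bij_betw (B z) {i \<in> I. f i = z} {j \<in> J. g j = z}"
    by metis
  have mem: "B (f i) i \<in> J \<and> g (B (f i) i) = f i" if "i \<in> I" for i
    using bij_betwE[OF B[of "f i"]] that by auto
  have "bij_betw (\<lambda>i. B (f i) i) I J"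
  proof (rule bij_betw_imageI)
    show "inj_on (\<lambda>i. B (f i) i) I"
    proof (rule inj_onI)
      fix i i' assume i: "i \<in> I" "i' \<in> I" "B (f i) i = B (f i') i'"
      then have "f i = f i'" using mem by metis
      then show "i = i'"
        using i B[of "f i"] by (auto simp: bij_betw_def inj_on_def)
    qed
    have "j \<in> (\<lambda>i. B (f i) i) ` I" if "j \<in> J" for j
    proof -
      have "j \<in> B (g j) ` {i \<in> I. f i = g j}"
        using B[of "g j"] that by (simp add: bij_betw_def)
      then obtain i where "i \<in> I" "f i = g j" "j = B (g j) i" by auto
      then show ?thesis by (intro image_eqI[of _ _ i]) simp_all
    qed
    then show "(\<lambda>i. B (f i) i) ` I = J" using mem by auto
  qed
  then show "(I, f) =\<^sub>m (J, g)"
    using mem by (auto simp: mset_eq_def)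
qed

lemma count_image_mset_set:
  "finite A \<Longrightarrow> count (image_mset f (mset_set A)) z = card {i \<in> A. f i = z}"
  by (auto simp: count_image_mset' intro!: arg_cong[where f = card])

lemma mset_eq_finite_iff:
  assumes "finite I" "finite J"
  shows "(I, f) =\<^sub>m (J, g) \<longleftrightarrow> image_mset f (mset_set I) = image_mset g (mset_set J)"
  using assms
  by (simp add: mset_eq_iff_multiplicities multiset_eq_iff count_image_mset_set eqpoll_iff_card)

definition mset_of_set :: "'a set \<Rightarrow> ('a, 'a) family" where
  "mset_of_set A = (A, id)"

definition copies :: "nat \<Rightarrow> ('i, 'a) family \<Rightarrow> (nat \<times> 'i, 'a) family" where
  "copies lam D = ({..<lam} \<times> fst D, (\<lambda>(_, i). snd D i))"

definition product_mset ::
  "'a set \<Rightarrow> 'a set \<Rightarrow> ('a, 'c) monoid_scheme \<Rightarrow> ('a \<times> 'a, 'a) family" where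
  "product_mset X Y K = (X \<times> Y, (\<lambda>(x, y). x \<otimes>\<^bsub>K\<^esub> y))"

definition near_factorization ::
  "nat \<Rightarrow> ('a, 'c) monoid_scheme \<Rightarrow> 'a set \<Rightarrow> 'a set \<Rightarrow> bool" where
  "near_factorization lam K X Y \<longleftrightarrow>
     X \<subseteq> carrier K \<and> Y \<subseteq> carrier K \<and>
     product_mset X Y K =\<^sub>m copies lam (mset_of_set (carrier K - {\<one>\<^bsub>K\<^esub>}))"

end

theory Submission
  imports Defs
begin

text \<open>
  Fix \<open>x = (g, h)\<close> in \<open>X\<close>. The products \<open>x * y\<close>, for \<open>y\<close> in \<open>Y\<close>, depend on the action only
  through the image of \<open>Y\<close> under \<open>\<Gamma> h\<close>: they are the left translates by \<open>(g, h)\<close>, in the direct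
  product, of the elements of that image, and each element of the image arises from
  exactly one \<open>y\<close> because \<open>\<Gamma> h\<close> is injective. So two actions whose automorphisms send \<open>Y\<close> to the
  same set, for every \<open>h\<close>, give the same multiset of products
  (\<open>product_mset_semidirect_eqI\<close>). For \<open>h = 0\<close> both automorphisms are the identity on \<open>G\<close>, which
  leaves \<open>h = 1\<close>: the hypothesis of the theorem.

  The two semidirect products have the same carrier and the same identity, so the near-factorization
  conditions compare the two multisets of products with one and the same multiset; the
  equivalence follows because \<open>=\<^sub>m\<close> is symmetric and transitive.
\<close>

lemma mset_eq_sym:
  assumes "D =\<^sub>m E"
  shows "E =\<^sub>m D"
proof -
  obtain I f J g where DE: "D = (I, f)" "E = (J, g)"
    by (cases D; cases E)
  have "{i \<in> I. f i = z} \<approx> {j \<in> J. g j = z}" for z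
    using assms unfolding DE mset_eq_iff_multiplicities by (rule spec)
  from eqpoll_sym[OF this] show ?thesis
    unfolding DE mset_eq_iff_multiplicities by (rule allI)
qed

lemma mset_eq_trans:
  assumes "D =\<^sub>m E" "E =\<^sub>m F"
  shows "D =\<^sub>m F"
proof -
  obtain I f J g K h where DEF: "D = (I, f)" "E = (J, g)" "F = (K, h)"
    by (cases D; cases E; cases F)
  have "{i \<in> I. f i = z} \<approx> {j \<in> J. g j = z}" for z
    using assms(1) unfolding DEF mset_eq_iff_multiplicities by (rule spec)
  moreover have "{j \<in> J. g j = z} \<approx> {k \<in> K. h k = z}" for z
    using assms(2) unfolding DEF mset_eq_iff_multiplicities by (rule spec)
  ultimately have "{i \<in> I. f i = z} \<approx> {k \<in> K. h k = z}" for z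
    by (rule eqpoll_trans)
  then show ?thesis
    unfolding DEF mset_eq_iff_multiplicities by (rule allI)
qed

lemma AutoGroup_hom_inj_on:
  assumes "\<Gamma> \<in> hom H (AutoGroup G)" "h \<in> carrier H"
  shows "inj_on (\<Gamma> h) (carrier G)"
  using assms by (auto simp: hom_def AutoGroup_def auto_def Bij_def bij_betw_def)

lemma AutoGroup_hom_one:
  assumes "group G" "group H" "\<Gamma> \<in> hom H (AutoGroup G)" "a \<in> carrier G"
  shows "\<Gamma> \<one>\<^bsub>H\<^esub> a = a"
proof -
  have "\<Gamma> \<one>\<^bsub>H\<^esub> = \<one>\<^bsub>AutoGroup G\<^esub>"
    using assms(3,2) group.AutoGroup[OF assms(1)] by (rule hom_one)
  then show ?thesis
    using assms(4) by (simp add: AutoGroup_def BijGroup_def)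
qed

text \<open>
  Two injective functions with the same image differ by a permutation of their domain. This is
  what turns the equality of the sets \<open>\<Gamma> h (Y)\<close> and \<open>\<Theta> h (Y)\<close> into a reindexing of products.
\<close>

lemma bij_betw_same_image:
  assumes "inj_on p A" "inj_on q A" "p ` A = q ` A"
  obtains b where "bij_betw b A A" "\<And>a. a \<in> A \<Longrightarrow> q (b a) = p a"
proof
  have p: "bij_betw p A (q ` A)"
    using assms by (simp add: bij_betw_def)
  have q: "bij_betw (inv_into A q) (q ` A) A"
    using assms by (simp add: bij_betw_inv_into inj_on_imp_bij_betw)
  show "bij_betw (inv_into A q \<circ> p) A A"
    using p q by (rule bij_betw_trans)
  show "q ((inv_into A q \<circ> p) a) = p a" if "a \<in> A" for a
    using assms(3) that by (auto intro!: f_inv_into_f)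
qed

lemma bij_betw_Sigma_fibrewise:
  assumes "\<And>x. x \<in> X \<Longrightarrow> bij_betw (b x) (Y x) (Z x)"
  shows "bij_betw (\<lambda>(x, y). (x, b x y)) (Sigma X Y) (Sigma X Z)"
proof (rule bij_betw_imageI)
  show "inj_on (\<lambda>(x, y). (x, b x y)) (Sigma X Y)"
    using assms by (auto simp: bij_betw_def inj_on_def)
  have "(\<lambda>(x, y). (x, b x y)) ` Sigma X Y = Sigma X (\<lambda>x. b x ` Y x)"
    by force
  then show "(\<lambda>(x, y). (x, b x y)) ` Sigma X Y = Sigma X Z"
    using assms by (simp add: bij_betw_def cong: Sigma_cong)
qed

text \<open>
  The products are reindexed one \<open>x\<close> at a time: for \<open>x = (g, h)\<close>, a permutation \<open>b h\<close> of \<open>Y\<close>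
  with \<open>\<Theta> h \<circ> b h = \<Gamma> h\<close> sends each factor \<open>y\<close> to one that has the same product with \<open>x\<close>.
  The choice depends on \<open>h\<close>, so in general no single permutation of \<open>Y\<close> serves all \<open>x\<close>.
\<close>

lemma product_mset_semidirect_eqI:
  assumes \<Gamma>: "\<And>h. h \<in> carrier H \<Longrightarrow> inj_on (\<Gamma> h) (carrier G)"
    and \<Theta>: "\<And>h. h \<in> carrier H \<Longrightarrow> inj_on (\<Theta> h) (carrier G)"
    and X: "X \<subseteq> carrier G \<times> carrier H"
    and Y: "Y \<subseteq> carrier G \<times> carrier H"
    and image: "\<And>h. h \<in> carrier H \<Longrightarrow> map_prod (\<Gamma> h) id ` Y = map_prod (\<Theta> h) id ` Y"
  shows "product_mset X Y (semidirect_product G H \<Gamma>)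
           =\<^sub>m product_mset X Y (semidirect_product G H \<Theta>)"
proof -
  have "\<exists>b. bij_betw b Y Y \<and> (\<forall>y\<in>Y. map_prod (\<Theta> h) id (b y) = map_prod (\<Gamma> h) id y)"
    if h: "h \<in> carrier H" for h
  proof -
    have "inj_on (map_prod (\<Gamma> h) id) Y" "inj_on (map_prod (\<Theta> h) id) Y"
      using map_prod_inj_on[OF \<Gamma>[OF h] inj_on_id] map_prod_inj_on[OF \<Theta>[OF h] inj_on_id] Y
      by (blast intro: inj_on_subset)+
    from bij_betw_same_image[OF this image[OF h]] show ?thesis
      by metis
  qed
  then obtain b where
    b: "\<And>h. h \<in> carrier H \<Longrightarrow> bij_betw (b h) Y Y"
       "\<And>h y. h \<in> carrier H \<Longrightarrow> y \<in> Y \<Longrightarrow> map_prod (\<Theta> h) id (b h y) = map_prod (\<Gamma> h) id y"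
    by metis
  have "bij_betw (\<lambda>(x, y). (x, b (snd x) y)) (X \<times> Y) (X \<times> Y)"
    using b(1) X by (intro bij_betw_Sigma_fibrewise) auto
  moreover have "x \<otimes>\<^bsub>semidirect_product G H \<Theta>\<^esub> b (snd x) y = x \<otimes>\<^bsub>semidirect_product G H \<Gamma>\<^esub> y"
    if "x \<in> X" "y \<in> Y" for x y
  proof -
    have "snd x \<in> carrier H"
      using X that by auto
    from b(2)[OF this \<open>y \<in> Y\<close>] show ?thesis
      by (auto simp: semidirect_product_def map_prod_def split: prod.splits)
  qed
  ultimately show ?thesis
    unfolding mset_eq_def product_mset_def by (intro exI conjI) auto
qed

lemma near_factorization_cong:
  assumes "carrier K = carrier L" "\<one>\<^bsub>K\<^esub> = \<one>\<^bsub>L\<^esub>"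
    and "product_mset X Y K =\<^sub>m product_mset X Y L"
  shows "near_factorization lam K X Y \<longleftrightarrow> near_factorization lam L X Y"
  unfolding near_factorization_def assms(1,2)
  using mset_eq_trans[OF assms(3)] mset_eq_trans[OF mset_eq_sym[OF assms(3)]] by blast

theorem theorem3p3:
  fixes G :: "('a, 'c) monoid_scheme"
    and \<Gamma> \<Theta> :: "int \<Rightarrow> 'a \<Rightarrow> 'a"
    and X Y :: "('a \<times> int) set"
  assumes "comm_group G"
    and "\<Gamma> \<in> hom (integer_mod_group 2) (AutoGroup G)"
    and "\<Theta> \<in> hom (integer_mod_group 2) (AutoGroup G)"
    and "X \<subseteq> carrier G \<times> carrier (integer_mod_group 2)"
    and "Y \<subseteq> carrier G \<times> carrier (integer_mod_group 2)"
    and "map_prod (\<Gamma> 1) id ` Y = map_prod (\<Theta> 1) id ` Y"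
  shows "product_mset X Y (semidirect_product G (integer_mod_group 2) \<Gamma>)
           =\<^sub>m product_mset X Y (semidirect_product G (integer_mod_group 2) \<Theta>)
       \<and> (\<forall>lam::nat. 0 < lam \<longrightarrow>
            (near_factorization lam (semidirect_product G (integer_mod_group 2) \<Gamma>) X Y
             \<longleftrightarrow> near_factorization lam (semidirect_product G (integer_mod_group 2) \<Theta>) X Y))"
proof -
  let ?Z = "integer_mod_group 2"
  have G: "group G"
    using \<open>comm_group G\<close> by (rule comm_group.axioms(2))
  have image: "map_prod (\<Gamma> h) id ` Y = map_prod (\<Theta> h) id ` Y" if "h \<in> carrier ?Z" for h
  proof -
    have "h = 0 \<or> h = 1"
      using that by (auto simp: carrier_integer_mod_group)
    then show ?thesis
    proof
      assume "h = 0"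
      have "\<Gamma> 0 a = \<Theta> 0 a" if "a \<in> carrier G" for a
        using AutoGroup_hom_one[OF G group_integer_mod_group assms(2) that]
          AutoGroup_hom_one[OF G group_integer_mod_group assms(3) that] by simp
      then show ?thesis
        unfolding \<open>h = 0\<close> using \<open>Y \<subseteq> _\<close> by (intro image_cong) auto
    next
      assume "h = 1"
      then show ?thesis
        using assms(6) by simp
    qed
  qed
  have eq: "product_mset X Y (semidirect_product G ?Z \<Gamma>)
      =\<^sub>m product_mset X Y (semidirect_product G ?Z \<Theta>)"
    using assms(2-5) by (intro product_mset_semidirect_eqI image AutoGroup_hom_inj_on)
  then have "near_factorization lam (semidirect_product G ?Z \<Gamma>) X Y
      \<longleftrightarrow> near_factorization lam (semidirect_product G ?Z \<Theta>) X Y" for lam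
    by (intro near_factorization_cong) (simp_all add: semidirect_product_def)
  with eq show ?thesis
    by blast
qed

end
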